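(* Let the intensities be $$\lambda^{(m)}(t)=\mu^{(m)} s(h(t))+\sum_{l=1}^M\ \sum_{i:\,t_{l,i}\le t-1}Y^{(l)}_{t_{l,i}}\Big(K_{l,m}+\alpha_{l,m}\mathbf 1(t_{l,i}\in A^{(l)})\Big)\beta(1-\beta)^{t-t_{l,i}-1}.$$ Then the log-likelihood $\log L(\theta\mid\tau,A)=\sum_{t=1}^{N_\delta}\sum_{m=1}^M\big(Y_t^{(m)}\log(\lambda^{(m)}(t))-\lambda^{(m)}(t)\big)$ can be rewritten as $$\log L(\theta\mid\tau,A)=\sum_{m=1}^M\sum_{t\in\tau^{(m)}}Y_t^{(m)}\log(\lambda^{(m)}(t))-\sum_{m=1}^M\sum_{l=1}^MK_{l,m}\sum_{t\in\tau^{(l)}}Y_t^{(l)}\big(1-(1-\beta)^{N_\delta-t}\big)$$ $$\qquad-\sum_{m=1}^M\sum_{l=1}^M\alpha_{l,m}\sum_{a\in A^{(l)}}Y_a^{(l)}\big(1-(1-\beta)^{N_\delta-a}\big)-\sum_{m=1}^M\mu^{(m)}\sum_{t=1}^{N_\delta}s(h(t)).$$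
   Context: Fix integers $M\ge1$ (number of dimensions) and $N_\delta\ge1$ (number of discrete time steps). For $l\in\{1,\dots,M\}$ and $t\in\{1,\dots,N_\delta\}$, $Y_t^{(l)}\in\{0,1,2,\dots\}$ is the observed number of events in dimension $l$ at time step $t$. The set of arrival times in dimension $l$ is $\tau^{(l)}=\{t: Y^{(l)}_t>0\}=\{t_{l,1}<\dots<t_{l,N_l}\}$; $A^{(l)}\subseteq\tau^{(l)}$ is the set of arrival times in dimension $l$ at which an alarm was sounded; $\tau$ and $A$ denote the collections of all $\tau^{(l)}$ and all $A^{(l)}$. The function $h:\{1,\dots,N_\delta\}\to\{1,\dots,24\}$ gives the hour of day of a time step and $s:\{1,\dots,24\}\to(0,1)$ is a fixed known function. The parameters are $\theta=(\mu^{(m)},K_{l,m},\alpha_{l,m},\beta)_{1\le l,m\le M}$ with $\mu^{(m)}>0$, $K_{l,m}>0$, $\alpha_{l,m}>0$, $\beta\in(0,1)$. $\mathbf 1(\cdot)$ is the indicator function. The log-likelihood is that of Poisson counts $Y_t^{(m)}\sim\mathrm{Poisson}(\lambda^{(m)}(t))$ given the past, with the parameter-free terms $-\log(Y_t^{(m)}!)$ omitted. *)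

theory Defs
  imports Complex_Main
begin

text \<open>
  Dimensions are indexed by \<open>{1..M}\<close> and time steps by \<open>{1..N}\<close>; \<open>Y l t\<close> is the number of
  events in dimension \<open>l\<close> at time step \<open>t\<close>.
\<close>

definition arrival_times :: "nat \<Rightarrow> (nat \<Rightarrow> nat \<Rightarrow> nat) \<Rightarrow> nat \<Rightarrow> nat set" where
  "arrival_times N Y l = {t \<in> {1..N}. Y l t > 0}"

text \<open>
  The increasing enumeration \<open>t\<^bsub>l,1\<^esub> < t\<^bsub>l,2\<^esub> < \<dots>\<close> of the arrival times in dimension \<open>l\<close>. It is
  meaningful only for \<open>i\<close> between 1 and the number of arrival times; the shift by one is due to
  lists being indexed from zero.
\<close>

definition arrival_time :: "nat \<Rightarrow> (nat \<Rightarrow> nat \<Rightarrow> nat) \<Rightarrow> nat \<Rightarrow> nat \<Rightarrow> nat" where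
  "arrival_time N Y l i = sorted_list_of_set (arrival_times N Y l) ! (i - 1)"

text \<open>
  The differences of time steps below are natural-number subtractions, but no truncation occurs
  for \<open>t \<ge> 1\<close>: the summation condition gives \<open>t - arrival_time N Y l i \<ge> 1\<close>.
\<close>

definition intensity ::
  "nat \<Rightarrow> nat \<Rightarrow> (nat \<Rightarrow> nat \<Rightarrow> nat) \<Rightarrow> (nat \<Rightarrow> nat set) \<Rightarrow> (nat \<Rightarrow> nat) \<Rightarrow> (nat \<Rightarrow> real) \<Rightarrow>
   (nat \<Rightarrow> real) \<Rightarrow> (nat \<Rightarrow> nat \<Rightarrow> real) \<Rightarrow> (nat \<Rightarrow> nat \<Rightarrow> real) \<Rightarrow> real \<Rightarrow> nat \<Rightarrow> nat \<Rightarrow> real" where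
  "intensity M N Y A h s \<mu> K \<alpha> \<beta> m t =
     \<mu> m * s (h t) +
     (\<Sum>l = 1..M. \<Sum>i | i \<in> {1..card (arrival_times N Y l)} \<and> arrival_time N Y l i \<le> t - 1.
        real (Y l (arrival_time N Y l i)) *
        (K l m + \<alpha> l m * (if arrival_time N Y l i \<in> A l then 1 else 0)) *
        (\<beta> * (1 - \<beta>) ^ (t - arrival_time N Y l i - 1)))"

text \<open>
  The log-likelihood of conditionally Poisson counts \<open>Y m t\<close> with means
  \<open>intensity M N Y A h s \<mu> K \<alpha> \<beta> m t\<close>, without the parameter-free terms \<open>- ln (fact (Y m t))\<close>.
\<close>

definition log_likelihood ::
  "nat \<Rightarrow> nat \<Rightarrow> (nat \<Rightarrow> nat \<Rightarrow> nat) \<Rightarrow> (nat \<Rightarrow> nat set) \<Rightarrow> (nat \<Rightarrow> nat) \<Rightarrow> (nat \<Rightarrow> real) \<Rightarrow>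
   (nat \<Rightarrow> real) \<Rightarrow> (nat \<Rightarrow> nat \<Rightarrow> real) \<Rightarrow> (nat \<Rightarrow> nat \<Rightarrow> real) \<Rightarrow> real \<Rightarrow> real" where
  "log_likelihood M N Y A h s \<mu> K \<alpha> \<beta> =
     (\<Sum>t = 1..N. \<Sum>m = 1..M.
        real (Y m t) * ln (intensity M N Y A h s \<mu> K \<alpha> \<beta> m t) - intensity M N Y A h s \<mu> K \<alpha> \<beta> m t)"

end

theory Submission
  imports Defs
begin

text \<open>
  An event at time \<open>u\<close> contributes to the intensities at the times \<open>u + 1, \<dots>, N\<close>, with weights
  forming a truncated geometric distribution of total mass \<open>1 - (1 - \<beta>) ^ (N - u)\<close>. Exchanging the
  summation over \<open>t\<close> with the one over past events therefore gives the closed form of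
  \<open>\<Sum>t. intensity t\<close>, while the logarithmic term vanishes off the arrival times.
\<close>

lemma finite_arrival_times [simp]: "finite (arrival_times N Y l)"
  by (simp add: arrival_times_def)

text \<open>The sorted list of a finite set is distinct, so \<open>(!)\<close> is a bijection from
  its positions. Composing with \<open>i - 1\<close> accounts for the enumeration starting at
  1.\<close>

lemma bij_betw_arrival_time:
  "bij_betw (arrival_time N Y l) {1..card (arrival_times N Y l)} (arrival_times N Y l)"
proof -
  let ?T = "arrival_times N Y l"
  have "bij_betw (\<lambda>i. i - 1) {1..card ?T} {..<card ?T}"
    by (rule bij_betw_byWitness[where f' = Suc]) auto
  moreover have "bij_betw ((!) (sorted_list_of_set ?T)) {..<card ?T} ?T"
    by (rule bij_betw_nth) auto
  ultimately have "bij_betw ((!) (sorted_list_of_set ?T) \<circ> (\<lambda>i. i - 1)) {1..card ?T} ?T"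
    by (rule bij_betw_trans)
  then show ?thesis
    by (simp add: comp_def arrival_time_def[abs_def])
qed

text \<open>Serves to remove the enumeration from the intensities: the summand and the condition
  depend on \<open>i\<close> only through the arrival time, so reindexing along the bijection
  applies.\<close>

lemma sum_arrival_time:
  "(\<Sum>i | i \<in> {1..card (arrival_times N Y l)} \<and> P (arrival_time N Y l i). f (arrival_time N Y l i)) =
   (\<Sum>u | u \<in> arrival_times N Y l \<and> P u. f u)"
proof -
  let ?I = "{1..card (arrival_times N Y l)}"
  have inj: "inj_on (arrival_time N Y l) ?I"
    and img: "arrival_time N Y l ` ?I = arrival_times N Y l"
    using bij_betw_arrival_time[of N Y l] unfolding bij_betw_def by blast+
  have "inj_on (arrival_time N Y l) {i. i \<in> ?I \<and> P (arrival_time N Y l i)}"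
    by (rule inj_on_subset[OF inj]) blast
  moreover have "arrival_time N Y l ` {i. i \<in> ?I \<and> P (arrival_time N Y l i)} =
      {u. u \<in> arrival_time N Y l ` ?I \<and> P u}"
    by blast
  ultimately show ?thesis
    unfolding img by (intro sum.reindex_bij_betw bij_betw_imageI)
qed

lemma intensity_eq:
  "intensity M N Y A h s \<mu> K \<alpha> \<beta> m t = \<mu> m * s (h t) +
    (\<Sum>l = 1..M. \<Sum>u | u \<in> arrival_times N Y l \<and> u \<le> t - 1.
       real (Y l u) * (K l m + \<alpha> l m * (if u \<in> A l then 1 else 0)) *
       (\<beta> * (1 - \<beta>) ^ (t - u - 1)))"
  unfolding intensity_def
  by (intro arg_cong2[where f = "(+)"] sum.cong refl
      sum_arrival_time[where P = "\<lambda>u. u \<le> t - 1"])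

lemma geometric_weights_sum:
  fixes \<beta> :: real
  assumes "u \<le> N"
  shows "(\<Sum>t | t \<in> {1..N} \<and> u \<le> t - 1. \<beta> * (1 - \<beta>) ^ (t - u - 1)) = 1 - (1 - \<beta>) ^ (N - u)"
proof -
  have "(\<Sum>t | t \<in> {1..N} \<and> u \<le> t - 1. \<beta> * (1 - \<beta>) ^ (t - u - 1)) =
      (\<Sum>j<N - u. \<beta> * (1 - \<beta>) ^ j)"
    \<comment> \<open>The lag \<open>j\<close> counts from 0 at the first affected step
      \<open>u + 1\<close>, and the last step \<open>N\<close> has lag \<open>N - u - 1\<close>. For
      \<open>u = N\<close> both sums are empty.\<close>
    by (rule sum.reindex_bij_witness[where i = "\<lambda>j. Suc (u + j)" and j = "\<lambda>t. t - u - 1"]) auto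
  also have "\<dots> = 1 - (1 - \<beta>) ^ (N - u)"
    by (simp add: one_diff_power_eq sum_distrib_left)
  finally show ?thesis .
qed

lemma sum_excitation:
  fixes \<beta> :: real
  assumes "finite T" and "\<And>u. u \<in> T \<Longrightarrow> u \<le> N"
  shows "(\<Sum>t = 1..N. \<Sum>u | u \<in> T \<and> u \<le> t - 1. f u * (\<beta> * (1 - \<beta>) ^ (t - u - 1))) =
    (\<Sum>u\<in>T. f u * (1 - (1 - \<beta>) ^ (N - u)))"
proof -
  have "(\<Sum>t = 1..N. \<Sum>u | u \<in> T \<and> u \<le> t - 1. f u * (\<beta> * (1 - \<beta>) ^ (t - u - 1))) =
      (\<Sum>u\<in>T. \<Sum>t | t \<in> {1..N} \<and> u \<le> t - 1. f u * (\<beta> * (1 - \<beta>) ^ (t - u - 1)))"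
    \<comment> \<open>The inner range depends on \<open>t\<close>, so the condition
      \<open>u \<le> t - 1\<close> has to travel with the swap and then restricts \<open>t\<close>
      instead.\<close>
    by (rule sum.swap_restrict) (use assms in auto)
  also have "\<dots> = (\<Sum>u\<in>T. f u * (1 - (1 - \<beta>) ^ (N - u)))"
    \<comment> \<open>Fixing the factor to \<open>f _\<close> keeps \<open>\<beta>\<close> inside
      the inner sum, the form in which the geometric sum is stated.\<close>
    unfolding sum_distrib_left[of "f _", symmetric]
    by (intro sum.cong refl) (simp only: geometric_weights_sum assms(2))
  finally show ?thesis .
qed

text \<open>Since \<open>B \<subseteq> T\<close>, the sum over \<open>B\<close> is a sum over
  \<open>T\<close> weighted by the indicator of \<open>B\<close>; the rest is linearity.\<close>

lemma sum_alarm_split: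
  fixes w :: "nat \<Rightarrow> real"
  assumes "finite T" and "B \<subseteq> T"
  shows "(\<Sum>u\<in>T. real (y u) * (k + a * (if u \<in> B then 1 else 0)) * w u) =
    k * (\<Sum>u\<in>T. real (y u) * w u) + a * (\<Sum>u\<in>B. real (y u) * w u)"
proof -
  have "(\<Sum>u\<in>B. real (y u) * w u) = (\<Sum>u\<in>T. if u \<in> B then real (y u) * w u else 0)"
    using assms by (simp add: sum.inter_restrict[symmetric] inf.absorb2)
  then show ?thesis
    by (simp only: sum_distrib_left sum.distrib[symmetric])
      (intro sum.cong refl, simp add: algebra_simps)
qed

lemma sum_intensity:
  assumes "\<forall>l \<in> {1..M}. A l \<subseteq> arrival_times N Y l"
  shows "(\<Sum>t = 1..N. intensity M N Y A h s \<mu> K \<alpha> \<beta> m t) =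
    \<mu> m * (\<Sum>t = 1..N. s (h t)) +
    (\<Sum>l = 1..M. K l m *
       (\<Sum>t \<in> arrival_times N Y l. real (Y l t) * (1 - (1 - \<beta>) ^ (N - t)))) +
    (\<Sum>l = 1..M. \<alpha> l m * (\<Sum>a \<in> A l. real (Y l a) * (1 - (1 - \<beta>) ^ (N - a))))"
proof -
  let ?g = "\<lambda>l u. real (Y l u) * (K l m + \<alpha> l m * (if u \<in> A l then 1 else 0))"
  have "(\<Sum>t = 1..N. intensity M N Y A h s \<mu> K \<alpha> \<beta> m t) =
      \<mu> m * (\<Sum>t = 1..N. s (h t)) +
      (\<Sum>t = 1..N. \<Sum>l = 1..M. \<Sum>u | u \<in> arrival_times N Y l \<and> u \<le> t - 1.
         ?g l u * (\<beta> * (1 - \<beta>) ^ (t - u - 1)))"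
    unfolding intensity_eq sum.distrib sum_distrib_left ..
  also have "(\<Sum>t = 1..N. \<Sum>l = 1..M. \<Sum>u | u \<in> arrival_times N Y l \<and> u \<le> t - 1.
         ?g l u * (\<beta> * (1 - \<beta>) ^ (t - u - 1))) =
      (\<Sum>l = 1..M. \<Sum>u\<in>arrival_times N Y l. ?g l u * (1 - (1 - \<beta>) ^ (N - u)))"
    \<comment> \<open>With \<open>l\<close> outermost, each dimension is an instance of
      \<open>sum_excitation\<close> with \<open>f = ?g l\<close>.\<close>
    by (subst sum.swap, intro sum.cong refl sum_excitation) (auto simp: arrival_times_def)
  also have "\<dots> = (\<Sum>l = 1..M.
      K l m * (\<Sum>t \<in> arrival_times N Y l. real (Y l t) * (1 - (1 - \<beta>) ^ (N - t))) +
      \<alpha> l m * (\<Sum>a \<in> A l. real (Y l a) * (1 - (1 - \<beta>) ^ (N - a))))"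
    using assms by (intro sum.cong refl sum_alarm_split) auto
  finally show ?thesis
    by (simp add: sum.distrib)
qed

theorem corollary5p1:
  fixes M N :: nat
    and Y :: "nat \<Rightarrow> nat \<Rightarrow> nat"
    and A :: "nat \<Rightarrow> nat set"
    and h :: "nat \<Rightarrow> nat"
    and s :: "nat \<Rightarrow> real"
    and \<mu> :: "nat \<Rightarrow> real"
    and K \<alpha> :: "nat \<Rightarrow> nat \<Rightarrow> real"
    and \<beta> :: real
  assumes "M \<ge> 1" and "N \<ge> 1"
    and "\<forall>l \<in> {1..M}. A l \<subseteq> arrival_times N Y l"
    and "\<forall>t \<in> {1..N}. h t \<in> {1..24}"
    and "\<forall>k \<in> {1..24}. s k \<in> {0<..<1}"
    and "\<forall>m \<in> {1..M}. \<mu> m > 0"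
    and "\<forall>l \<in> {1..M}. \<forall>m \<in> {1..M}. K l m > 0"
    and "\<forall>l \<in> {1..M}. \<forall>m \<in> {1..M}. \<alpha> l m > 0"
    and "\<beta> \<in> {0<..<1}"
  shows "log_likelihood M N Y A h s \<mu> K \<alpha> \<beta> =
      (\<Sum>m = 1..M. \<Sum>t \<in> arrival_times N Y m.
         real (Y m t) * ln (intensity M N Y A h s \<mu> K \<alpha> \<beta> m t))
    - (\<Sum>m = 1..M. \<Sum>l = 1..M. K l m *
         (\<Sum>t \<in> arrival_times N Y l. real (Y l t) * (1 - (1 - \<beta>) ^ (N - t))))
    - (\<Sum>m = 1..M. \<Sum>l = 1..M. \<alpha> l m *
         (\<Sum>a \<in> A l. real (Y l a) * (1 - (1 - \<beta>) ^ (N - a))))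
    - (\<Sum>m = 1..M. \<mu> m * (\<Sum>t = 1..N. s (h t)))"
proof -
  let ?\<Lambda> = "intensity M N Y A h s \<mu> K \<alpha> \<beta>"
  have log_part: "(\<Sum>t = 1..N. real (Y m t) * ln (?\<Lambda> m t)) =
      (\<Sum>t \<in> arrival_times N Y m. real (Y m t) * ln (?\<Lambda> m t))" for m
    \<comment> \<open>The factor \<open>Y m t = 0\<close> annihilates the term whatever the value of
      \<open>ln\<close>.\<close>
    by (rule sum.mono_neutral_right) (auto simp: arrival_times_def)
  have "log_likelihood M N Y A h s \<mu> K \<alpha> \<beta> =
      (\<Sum>m = 1..M. \<Sum>t = 1..N. real (Y m t) * ln (?\<Lambda> m t) - ?\<Lambda> m t)"
    unfolding log_likelihood_def by (rule sum.swap)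
  then show ?thesis
    \<comment> \<open>\<open>diff_diff_eq\<close> merges the successive subtractions into one
      subtracted sum, whose order \<open>add_ac\<close> normalizes.\<close>
    by (simp only: sum_subtractf log_part sum_intensity[OF assms(3)] sum.distrib
        diff_diff_eq add_ac)
qed

end
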